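(* Let $t\geq 1$ and $n\geq 1$ be integers and let $0<\alpha<1$ be such that the pair $(n,\alpha)$ is feasible, that is, $\lceil(1-\alpha)(n+1)\rceil\leq n$. Let the data sequence $(X_{-t+1},Y_{-t+1}),\dots,(X_0,Y_0),(X_1,Y_1),(X_2,Y_2),\dots$ be exchangeable, and let $\rho$ be a conformity function that is regular with respect to this data sequence. Then the sequence of coverage indicators $\{Z_i\}_{i\geq 1}$ is exchangeable and, for every future batch size $m\geq 1$, the random variable $m\times C^{(n,\alpha)}_m$ has the $\text{Beta-Binomial}(\lceil(1-\alpha)(n+1)\rceil,\lfloor\alpha(n+1)\rfloor)$ distribution (with $m$ trials), so that the distribution of the empirical coverage $C^{(n,\alpha)}_m$ is given by $$ P\left(C^{(n,\alpha)}_m=\frac{k}{m}\right) = \binom{m}{k}\,\frac{n!\,(k+\lceil(1-\alpha)(n+1)\rceil-1)!\,(m-k+\lfloor\alpha(n+1)\rfloor-1)!}{(\lceil(1-\alpha)(n+1)\rceil-1)!\,(\lfloor\alpha(n+1)\rfloor-1)!\,(m+n)!}\,, $$ for $k=0,1,\dots,m$ and every $m\geq 1$.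
   Context: Let $(\Omega,\mathscr{F},P)$ be a probability space on which all random objects are defined. A sequence of random objects is exchangeable if, for every $N\geq 1$, the joint distribution of its first $N$ terms is invariant under every permutation of those $N$ terms. For real $s$, $\lceil s\rceil$ and $\lfloor s\rfloor$ denote the ceiling and the floor of $s$. Let $d\geq 1$, and let $\mathscr{Y}$ be either $\mathbb{R}$ (regression) or a finite set of class labels $\{1,\dots,L\}$ (classification). The data sequence consists of random pairs $(X_i,Y_i)$ taking values in $\mathbb{R}^d\times\mathscr{Y}$, indexed by the integers $i\geq -t+1$. Here $T=((X_{-t+1},Y_{-t+1}),\dots,(X_0,Y_0))$ is the training sample, $((X_1,Y_1),\dots,(X_n,Y_n))$ is the calibration sample, and $\{(X_{n+i},Y_{n+i})\}_{i\geq 1}$ is the sequence of future observables. Exchangeability of the data sequence refers to the whole sequence, including the training sample. Let $\mathscr{T}=\sigma(T)$ be the smallest sub-$\sigma$-field of $\mathscr{F}$ with respect to which $T$ is measurable. A conformity function is a mapping $\rho:\mathbb{R}^d\times\mathscr{Y}\times\Omega\to\mathbb{R}$ such that $\omega\mapsto\rho(x,y,\omega)$ is $\mathscr{T}$-measurable for every $x\in\mathbb{R}^d$ and every $y\in\mathscr{Y}$. The associated conformity scores are $S_i(\omega)=\rho(X_i(\omega),Y_i(\omega),\omega)$, $i\geq 1$. The conformity function $\rho$ is regular with respect to the data sequence if almost surely there are no ties among $\{S_i\}_{i\geq 1}$. Let $S_{(1)},\dots,S_{(n)}$ be the calibration sample conformity scores $S_1,\dots,S_n$ arranged in increasing order.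 The number $\alpha$ is the nominal miscoverage level. The random conformal prediction set is $$D^{(\alpha)}_n(x,\omega)=\left\{y\in\mathscr{Y}:\rho(x,y,\omega)\leq S_{(\lceil(1-\alpha)(n+1)\rceil)}(\omega)\right\},$$ and $D^{(\alpha)}_n(x)=D^{(\alpha)}_n(x,\cdot)$. The coverage indicators are $Z_i=1$ if $Y_{n+i}\in D^{(\alpha)}_n(X_{n+i})$ and $Z_i=0$ otherwise, for $i\geq 1$. The empirical coverage of a batch of $m\geq 1$ future observables is $C^{(n,\alpha)}_m=\frac{1}{m}\sum_{i=1}^m Z_i$. The $\text{Beta-Binomial}(b,g)$ distribution with $m$ trials is the law of a random variable that, conditionally on $\theta$, is $\text{Binomial}(m,\theta)$, where $\theta$ has the $\text{Beta}(b,g)$ distribution.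
   Formalization: The conformity function ρ is additionally assumed jointly measurable in (x, y, ω) with respect to the Borel sets, the labels and σ(T); with only measurability in ω for each fixed (x, y), the claim fails for functions ρ that are non-measurable in x. *)

theory Defs
  imports "HOL-Probability.Probability"
begin

text \<open>A sequence indexed by the integers \<open>i \<ge> a\<close>, with values in the measurable space \<open>K\<close>.\<close>

definition exchangeable ::
    "'w measure \<Rightarrow> 'b measure \<Rightarrow> int \<Rightarrow> (int \<Rightarrow> 'w \<Rightarrow> 'b) \<Rightarrow> bool" where
  "exchangeable M K a V \<longleftrightarrow>
     (\<forall>i\<ge>a. V i \<in> measurable M K) \<and>
     (\<forall>N\<ge>1. \<forall>\<pi>. \<pi> permutes {a..<a + int N} \<longrightarrow>
        distr M (PiM {a..<a + int N} (\<lambda>_. K)) (\<lambda>\<omega>. \<lambda>i\<in>{a..<a + int N}. V (\<pi> i) \<omega>) =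
        distr M (PiM {a..<a + int N} (\<lambda>_. K)) (\<lambda>\<omega>. \<lambda>i\<in>{a..<a + int N}. V i \<omega>))"

text \<open>
  The Beta law lives on the open unit interval, because \<^const>\<open>binomial_pmf\<close> is
  unspecified for parameters outside \<open>[0, 1]\<close>.
\<close>

definition beta_distribution :: "real \<Rightarrow> real \<Rightarrow> real measure" where
  "beta_distribution b g =
     density (restrict_space lborel {0<..<1})
       (\<lambda>\<theta>. ennreal (\<theta> powr (b - 1) * (1 - \<theta>) powr (g - 1) / Beta b g))"

definition beta_binomial :: "nat \<Rightarrow> real \<Rightarrow> real \<Rightarrow> nat measure" where
  "beta_binomial m b g = beta_distribution b g \<bind> (\<lambda>\<theta>. measure_pmf (binomial_pmf m \<theta>))"

lemma prob_space_beta_distribution: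
  assumes "b > 0" "g > 0"
  shows "prob_space (beta_distribution b g)"
proof
  let ?f = "\<lambda>\<theta>::real. \<theta> powr (b - 1) * (1 - \<theta>) powr (g - 1) / Beta b g"
  have B: "Beta b g > 0"
    using assms by (simp add: Beta_def Gamma_real_pos)
  have "((\<lambda>t. t powr (b - 1) * (1 - t) powr (g - 1)) has_integral Beta b g) {0<..<1}"
    using has_integral_Beta_real[OF assms] by (simp add: has_integral_Icc_iff_Ioo)
  then have "(?f has_integral (Beta b g / Beta b g)) {0<..<1}"
    by (rule has_integral_divide)
  then have I: "(?f has_integral 1) {0<..<1}"
    using B by simp
  have "(\<integral>\<^sup>+\<theta>. ennreal (?f \<theta>) * indicator {0<..<1} \<theta> \<partial>lborel) = ennreal 1"
    by (rule nn_integral_has_integral_lebesgue'[OF _ I]) (use B in auto)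
  moreover have "emeasure (beta_distribution b g) (space (beta_distribution b g)) =
      (\<integral>\<^sup>+\<theta>. ennreal (?f \<theta>) \<partial>restrict_space lborel {0<..<1})"
    unfolding beta_distribution_def
    by (subst emeasure_density)
       (auto simp: measurable_restrict_space1 sets_restrict_space_iff intro!: nn_integral_cong)
  ultimately show "emeasure (beta_distribution b g) (space (beta_distribution b g)) = 1"
    by (simp add: nn_integral_restrict_space)
qed

lemma measurable_binomial_kernel:
  "(\<lambda>\<theta>. measure_pmf (binomial_pmf m \<theta>))
     \<in> measurable (beta_distribution b g) (subprob_algebra (count_space UNIV))"
proof (rule measurable_subprob_algebra)
  fix A :: "nat set"
  assume "A \<in> sets (count_space UNIV)"
  have eq: "emeasure (measure_pmf (binomial_pmf m \<theta>)) A =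
      (\<Sum>k\<in>A \<inter> {..m}. ennreal (real (m choose k) * \<theta> ^ k * (1 - \<theta>) ^ (m - k)))"
    if "\<theta> \<in> space (beta_distribution b g)" for \<theta>
  proof -
    have \<theta>: "0 < \<theta>" "\<theta> < 1"
      using that by (auto simp: beta_distribution_def space_restrict_space)
    then have "emeasure (measure_pmf (binomial_pmf m \<theta>)) A =
        emeasure (measure_pmf (binomial_pmf m \<theta>)) (A \<inter> {..m})"
      by (metis emeasure_Int_set_pmf set_pmf_binomial)
    also have "\<dots> = (\<Sum>k\<in>A \<inter> {..m}. ennreal (pmf (binomial_pmf m \<theta>) k))"
      by (simp add: emeasure_measure_pmf_finite)
    finally show ?thesis
      using \<theta> by simp
  qed
  have "(\<lambda>\<theta>. \<Sum>k\<in>A \<inter> {..m}. ennreal (real (m choose k) * \<theta> ^ k * (1 - \<theta>) ^ (m - k)))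
      \<in> borel_measurable (beta_distribution b g)"
    unfolding beta_distribution_def by (simp add: measurable_restrict_space1)
  then show "(\<lambda>\<theta>. emeasure (measure_pmf (binomial_pmf m \<theta>)) A)
      \<in> borel_measurable (beta_distribution b g)"
    by (subst measurable_cong[OF eq])
qed (auto intro: measure_pmf.subprob_space_axioms)

lemma emeasure_beta_binomial:
  "emeasure (beta_binomial m b g) {k} =
     (\<integral>\<^sup>+\<theta>. ennreal (real (m choose k) * \<theta> ^ k * (1 - \<theta>) ^ (m - k)) \<partial>beta_distribution b g)"
proof -
  have "space (beta_distribution b g) = {0<..<1}"
    by (simp add: beta_distribution_def space_restrict_space)
  moreover from this have "space (beta_distribution b g) \<noteq> {}"
    by simp
  ultimately show ?thesis
    unfolding beta_binomial_def
    by (subst emeasure_bind[OF _ measurable_binomial_kernel])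
       (auto intro!: nn_integral_cong simp: emeasure_pmf_single)
qed

text \<open>
  Labels are real numbers: all of them for regression, \<open>1, \<dots>, L\<close> for classification. On a
  finite set of labels the Borel sets are all the subsets.
\<close>

definition label_set :: "real set \<Rightarrow> bool" where
  "label_set \<Y> \<longleftrightarrow> \<Y> = UNIV \<or> (\<exists>L\<ge>1. \<Y> = real ` {1..L})"

definition observable_space :: "real set \<Rightarrow> ((real ^ 'd) \<times> real) measure" where
  "observable_space \<Y> = borel \<Otimes>\<^sub>M restrict_space borel \<Y>"

definition training_algebra ::
    "'w measure \<Rightarrow> real set \<Rightarrow> nat \<Rightarrow> (int \<Rightarrow> 'w \<Rightarrow> real ^ 'd) \<Rightarrow> (int \<Rightarrow> 'w \<Rightarrow> real) \<Rightarrow> 'w measure"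
  where
  "training_algebra M \<Y> t X Y =
     vimage_algebra (space M) (\<lambda>\<omega>. \<lambda>i\<in>{1 - int t..0}. (X i \<omega>, Y i \<omega>))
       (PiM {1 - int t..0} (\<lambda>_. observable_space \<Y>))"

definition conformity_function ::
    "'w measure \<Rightarrow> real set \<Rightarrow> nat \<Rightarrow> (int \<Rightarrow> 'w \<Rightarrow> real ^ 'd) \<Rightarrow> (int \<Rightarrow> 'w \<Rightarrow> real) \<Rightarrow>
     (real ^ 'd \<Rightarrow> real \<Rightarrow> 'w \<Rightarrow> real) \<Rightarrow> bool" where
  "conformity_function M \<Y> t X Y \<rho> \<longleftrightarrow>
     (\<forall>x. \<forall>y\<in>\<Y>. \<rho> x y \<in> borel_measurable (training_algebra M \<Y> t X Y))"

text \<open>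
  Measurability of every section \<open>\<rho> x y\<close> does not make the scores random variables, and even if
  they are, they need not be exchangeable: \<open>\<rho> x y \<omega>\<close> may be a non-measurable function of \<open>x\<close>
  alone. That the scores are random variables obtained from \<open>X i\<close>, \<open>Y i\<close> and the training sample
  is expressed by measurability in all the arguments together.
\<close>

definition jointly_measurable ::
    "'w measure \<Rightarrow> real set \<Rightarrow> nat \<Rightarrow> (int \<Rightarrow> 'w \<Rightarrow> real ^ 'd) \<Rightarrow> (int \<Rightarrow> 'w \<Rightarrow> real) \<Rightarrow>
     (real ^ 'd \<Rightarrow> real \<Rightarrow> 'w \<Rightarrow> real) \<Rightarrow> bool" where
  "jointly_measurable M \<Y> t X Y \<rho> \<longleftrightarrow>
     (\<lambda>((x, y), \<omega>). \<rho> x y \<omega>)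
       \<in> borel_measurable (observable_space \<Y> \<Otimes>\<^sub>M training_algebra M \<Y> t X Y)"

definition score ::
    "(int \<Rightarrow> 'w \<Rightarrow> real ^ 'd) \<Rightarrow> (int \<Rightarrow> 'w \<Rightarrow> real) \<Rightarrow> (real ^ 'd \<Rightarrow> real \<Rightarrow> 'w \<Rightarrow> real) \<Rightarrow>
     int \<Rightarrow> 'w \<Rightarrow> real" where
  "score X Y \<rho> i \<omega> = \<rho> (X i \<omega>) (Y i \<omega>) \<omega>"

definition regular ::
    "'w measure \<Rightarrow> (int \<Rightarrow> 'w \<Rightarrow> real ^ 'd) \<Rightarrow> (int \<Rightarrow> 'w \<Rightarrow> real) \<Rightarrow>
     (real ^ 'd \<Rightarrow> real \<Rightarrow> 'w \<Rightarrow> real) \<Rightarrow> bool" where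
  "regular M X Y \<rho> \<longleftrightarrow> (AE \<omega> in M. inj_on (\<lambda>i. score X Y \<rho> i \<omega>) {1..})"

definition order_statistic :: "nat \<Rightarrow> (int \<Rightarrow> real) \<Rightarrow> nat \<Rightarrow> real" where
  "order_statistic n s k = sort (map s [1..int n]) ! (k - 1)"

definition feasible :: "nat \<Rightarrow> real \<Rightarrow> bool" where
  "feasible n \<alpha> \<longleftrightarrow> \<lceil>(1 - \<alpha>) * (real n + 1)\<rceil> \<le> int n"

definition prediction_set ::
    "real set \<Rightarrow> (int \<Rightarrow> 'w \<Rightarrow> real ^ 'd) \<Rightarrow> (int \<Rightarrow> 'w \<Rightarrow> real) \<Rightarrow>
     (real ^ 'd \<Rightarrow> real \<Rightarrow> 'w \<Rightarrow> real) \<Rightarrow> nat \<Rightarrow> real \<Rightarrow> real ^ 'd \<Rightarrow> 'w \<Rightarrow> real set" where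
  "prediction_set \<Y> X Y \<rho> n \<alpha> x \<omega> =
     {y \<in> \<Y>. \<rho> x y \<omega> \<le>
        order_statistic n (\<lambda>i. score X Y \<rho> i \<omega>) (nat \<lceil>(1 - \<alpha>) * (real n + 1)\<rceil>)}"

definition coverage_indicator ::
    "real set \<Rightarrow> (int \<Rightarrow> 'w \<Rightarrow> real ^ 'd) \<Rightarrow> (int \<Rightarrow> 'w \<Rightarrow> real) \<Rightarrow>
     (real ^ 'd \<Rightarrow> real \<Rightarrow> 'w \<Rightarrow> real) \<Rightarrow> nat \<Rightarrow> real \<Rightarrow> int \<Rightarrow> 'w \<Rightarrow> real" where
  "coverage_indicator \<Y> X Y \<rho> n \<alpha> i \<omega> =
     (if Y (int n + i) \<omega> \<in> prediction_set \<Y> X Y \<rho> n \<alpha> (X (int n + i) \<omega>) \<omega> then 1 else 0)"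

definition empirical_coverage ::
    "real set \<Rightarrow> (int \<Rightarrow> 'w \<Rightarrow> real ^ 'd) \<Rightarrow> (int \<Rightarrow> 'w \<Rightarrow> real) \<Rightarrow>
     (real ^ 'd \<Rightarrow> real \<Rightarrow> 'w \<Rightarrow> real) \<Rightarrow> nat \<Rightarrow> real \<Rightarrow> nat \<Rightarrow> 'w \<Rightarrow> real" where
  "empirical_coverage \<Y> X Y \<rho> n \<alpha> m \<omega> =
     1 / real m * (\<Sum>i = 1..int m. coverage_indicator \<Y> X Y \<rho> n \<alpha> i \<omega>)"

end

theory Submission
  imports Defs
begin

text \<open>
  Given the training sample, the score \<open>S i\<close> is a fixed function of the \<open>i\<close>-th observable, so the
  scores inherit exchangeability: permute the observables of index at least 1 and leave the training
  sample alone. The coverage indicators inherit it from the scores in the same way, with the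
  calibration sample as the part that is left alone.

  For the law of the number of covered observables put \<open>N = n + m\<close>. Almost surely there are no ties,
  and then the set \<open>A\<close> of indices whose scores lie below \<open>S j\<close> determines \<open>j\<close> among all sets of
  its size. By exchangeability the \<open>N * (N - 1 choose r)\<close> events ``\<open>A\<close> lies below \<open>j\<close>'' with
  \<open>card A = r\<close> are equally likely. Exactly \<open>k\<close> observables are covered iff the \<open>b\<close>-th smallest
  calibration score has \<open>b - 1\<close> calibration scores and \<open>k\<close> future scores below it, which is the union
  of \<open>n * (n - 1 choose b - 1) * (m choose k)\<close> of these events with \<open>r = b - 1 + k\<close>.
\<close>

subsection \<open>Exchangeability of transformed sequences\<close>

text \<open>Both coordinates are measurable for the \<sigma>-algebra generated by the map sending
  \<open>(x, \<omega>)\<close> to \<open>(T \<omega>, x)\<close>, so that algebra contains the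
  product. Thus dependence on \<open>\<omega>\<close> through \<open>\<sigma>(T)\<close> becomes
  dependence on the value \<open>T \<omega>\<close>. The swap puts the fixed part first, as
  \<open>exchangeable_transform\<close> expects.\<close>

lemma sets_pair_vimage_algebra:
  assumes T: "T \<in> \<Omega> \<rightarrow> space N" and B: "B \<in> sets (K \<Otimes>\<^sub>M vimage_algebra \<Omega> T N)"
  shows "\<exists>B'\<in>sets (N \<Otimes>\<^sub>M K). \<forall>x\<in>space K. \<forall>\<omega>\<in>\<Omega>. (x, \<omega>) \<in> B \<longleftrightarrow> (T \<omega>, x) \<in> B'"
proof -
  let ?g = "\<lambda>(x, \<omega>). (T \<omega>, x)"
  let ?X = "space K \<times> \<Omega>"
  have g: "?g \<in> ?X \<rightarrow> space (N \<Otimes>\<^sub>M K)"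
    using T by (auto simp: space_pair_measure)
  have "?g \<in> measurable (vimage_algebra ?X ?g (N \<Otimes>\<^sub>M K)) (N \<Otimes>\<^sub>M K)"
    by (rule measurable_vimage_algebra1[OF g])
  then have 1: "(\<lambda>p. snd (?g p)) \<in> measurable (vimage_algebra ?X ?g (N \<Otimes>\<^sub>M K)) K"
    and 2: "(\<lambda>p. fst (?g p)) \<in> measurable (vimage_algebra ?X ?g (N \<Otimes>\<^sub>M K)) N"
    by (auto intro: measurable_compose[OF _ measurable_snd] measurable_compose[OF _ measurable_fst])
  have "(\<lambda>p. (fst p, snd p)) \<in> measurable (vimage_algebra ?X ?g (N \<Otimes>\<^sub>M K)) (K \<Otimes>\<^sub>M vimage_algebra \<Omega> T N)"
  proof (rule measurable_Pair)
    show "fst \<in> measurable (vimage_algebra ?X ?g (N \<Otimes>\<^sub>M K)) K"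
      using 1 by (simp add: case_prod_beta)
    show "snd \<in> measurable (vimage_algebra ?X ?g (N \<Otimes>\<^sub>M K)) (vimage_algebra \<Omega> T N)"
      by (rule measurable_vimage_algebra2) (use 2 in \<open>auto simp: case_prod_beta\<close>)
  qed
  from measurable_sets[OF this B] have "B \<inter> ?X \<in> sets (vimage_algebra ?X ?g (N \<Otimes>\<^sub>M K))"
    by simp
  then obtain B' where B': "B' \<in> sets (N \<Otimes>\<^sub>M K)" "B \<inter> ?X = ?g -` B' \<inter> ?X"
    by (auto simp: sets_vimage_algebra2[OF g])
  have "(x, \<omega>) \<in> B \<longleftrightarrow> (T \<omega>, x) \<in> B'" if "x \<in> space K" "\<omega> \<in> \<Omega>" for x \<omega>
  proof -
    have "(x, \<omega>) \<in> B \<inter> ?X \<longleftrightarrow> (x, \<omega>) \<in> ?g -` B' \<inter> ?X"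
      by (simp only: B'(2))
    with that show ?thesis by simp
  qed
  with B'(1) show ?thesis by blast
qed

text \<open>Lifts a permutation of the indices of a transformed sequence to the original one: the
  head below \<open>a' + d\<close> stays fixed, and the tail is moved by \<open>\<pi>\<close>
  conjugated with the shift by \<open>d\<close>.\<close>

lemma permutes_shift_tail:
  fixes a' d :: int
  assumes \<pi>: "\<pi> permutes {a'..<a' + int N}" and a: "a \<le> a' + d"
  shows "(\<lambda>j. if j < a' + d then j else \<pi> (j - d) + d) permutes {a..<a' + d + int N}"
    (is "?\<pi>' permutes ?J")
proof (rule bij_imp_permutes)
  let ?\<pi>i = "\<lambda>j. if j < a' + d then j else inv \<pi> (j - d) + d"
  have in1: "\<pi> i \<in> {a'..<a' + int N}" "inv \<pi> i \<in> {a'..<a' + int N}" if "i \<in> {a'..<a' + int N}" for i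
    using permutes_in_image[OF \<pi>] permutes_in_image[OF permutes_inv[OF \<pi>]] that by blast+
  show "bij_betw ?\<pi>' ?J ?J"
  proof (rule bij_betw_byWitness[where f' = ?\<pi>i])
    show "\<forall>j\<in>?J. ?\<pi>i (?\<pi>' j) = j"
    proof
      fix j assume "j \<in> ?J"
      then show "?\<pi>i (?\<pi>' j) = j"
        using in1(1)[of "j - d"] permutes_inverses[OF \<pi>] by auto
    qed
    show "\<forall>j\<in>?J. ?\<pi>' (?\<pi>i j) = j"
    proof
      fix j assume "j \<in> ?J"
      then show "?\<pi>' (?\<pi>i j) = j"
        using in1(2)[of "j - d"] permutes_inverses[OF \<pi>] by auto
    qed
    show "?\<pi>' ` ?J \<subseteq> ?J"
    proof
      fix l assume "l \<in> ?\<pi>' ` ?J"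
      then obtain j where j: "j \<in> ?J" "l = ?\<pi>' j"
        by blast
      then show "l \<in> ?J"
        using in1(1)[of "j - d"] a by (cases "j < a' + d") auto
    qed
    show "?\<pi>i ` ?J \<subseteq> ?J"
    proof
      fix l assume "l \<in> ?\<pi>i ` ?J"
      then obtain j where j: "j \<in> ?J" "l = ?\<pi>i j"
        by blast
      then show "l \<in> ?J"
        using in1(2)[of "j - d"] a by (cases "j < a' + d") auto
    qed
  qed
next
  fix j assume "j \<notin> ?J"
  then show "?\<pi>' j = j"
    using permutes_not_in[OF \<pi>, of "j - d"] a by auto
qed

lemma exchangeable_emeasure_eq:
  assumes V: "exchangeable M K a V" and J: "J = {a..<e}" "a < e" and \<pi>: "\<pi> permutes J"
    and C: "C \<in> sets (PiM J (\<lambda>_. K))"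
  shows "emeasure M {\<omega> \<in> space M. (\<lambda>i\<in>J. V (\<pi> i) \<omega>) \<in> C} = emeasure M {\<omega> \<in> space M. (\<lambda>i\<in>J. V i \<omega>) \<in> C}"
proof -
  define N where "N = nat (e - a)"
  have N: "J = {a..<a + int N}" "N \<ge> 1"
    using J by (auto simp: N_def)
  have m: "V i \<in> measurable M K" if "i \<in> J" for i
    using V J that by (auto simp: exchangeable_def)
  have m': "V (\<pi> i) \<in> measurable M K" if "i \<in> J" for i
    using m permutes_in_image[OF \<pi>] that by blast
  have "distr M (PiM J (\<lambda>_. K)) (\<lambda>\<omega>. \<lambda>i\<in>J. V (\<pi> i) \<omega>) = distr M (PiM J (\<lambda>_. K)) (\<lambda>\<omega>. \<lambda>i\<in>J. V i \<omega>)"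
    using V N \<pi> by (simp add: exchangeable_def)
  then have "emeasure (distr M (PiM J (\<lambda>_. K)) (\<lambda>\<omega>. \<lambda>i\<in>J. V (\<pi> i) \<omega>)) C =
      emeasure (distr M (PiM J (\<lambda>_. K)) (\<lambda>\<omega>. \<lambda>i\<in>J. V i \<omega>)) C"
    by simp
  then show ?thesis
    using C m m' by (simp add: emeasure_distr measurable_restrict vimage_def Int_def conj_commute)
qed

text \<open>
  The membership condition in the second hypothesis on \<open>W\<close> says that \<open>W i\<close> is one fixed function of
  \<open>V a, \<dots>, V (a' + d - 1)\<close> and \<open>V (i + d)\<close>. It is phrased with preimages because the scores
  are only known to be measurable with respect to \<open>\<sigma>(T)\<close>, and this avoids factoring them
  through \<open>T\<close>.
\<close>

lemma exchangeable_transform: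
  assumes M: "prob_space M" and V: "exchangeable M K a V" and a: "a \<le> a' + d"
    and sp: "\<And>i \<omega>. i \<ge> a' \<Longrightarrow> \<omega> \<in> space M \<Longrightarrow> W i \<omega> \<in> space K'"
    and W: "\<And>A. A \<in> sets K' \<Longrightarrow> \<exists>B\<in>sets (PiM {a..<a' + d} (\<lambda>_. K) \<Otimes>\<^sub>M K).
      \<forall>i\<ge>a'. \<forall>\<omega>\<in>space M. W i \<omega> \<in> A \<longleftrightarrow> (\<lambda>j\<in>{a..<a' + d}. V j \<omega>, V (i + d) \<omega>) \<in> B"
  shows "exchangeable M K' a' W"
proof -
  interpret prob_space M by (rule M)
  have mV: "V i \<in> measurable M K" if "i \<ge> a" for i
    using V that by (auto simp: exchangeable_def)
  have mW: "W i \<in> measurable M K'" if i: "i \<ge> a'" for i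
  proof (rule measurableI)
    fix A assume "A \<in> sets K'"
    from W[OF this] i obtain B where B: "B \<in> sets (PiM {a..<a' + d} (\<lambda>_. K) \<Otimes>\<^sub>M K)"
      "\<And>\<omega>. \<omega> \<in> space M \<Longrightarrow> W i \<omega> \<in> A \<longleftrightarrow> (\<lambda>j\<in>{a..<a' + d}. V j \<omega>, V (i + d) \<omega>) \<in> B"
      by meson
    have "(\<lambda>\<omega>. (\<lambda>j\<in>{a..<a' + d}. V j \<omega>, V (i + d) \<omega>)) \<in> measurable M (PiM {a..<a' + d} (\<lambda>_. K) \<Otimes>\<^sub>M K)"
      using mV a i by (intro measurable_Pair measurable_restrict) auto
    from measurable_sets[OF this B(1)] show "W i -` A \<inter> space M \<in> sets M"
      by (rule back_subst[of "\<lambda>X. X \<in> sets M"]) (use B(2) in auto)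
  qed (use sp i in auto)
  have eq: "distr M (PiM J' (\<lambda>_. K')) (\<lambda>\<omega>. \<lambda>i\<in>J'. W (\<pi> i) \<omega>) =
      distr M (PiM J' (\<lambda>_. K')) (\<lambda>\<omega>. \<lambda>i\<in>J'. W i \<omega>)" (is "?L = ?R")
    if N: "N \<ge> 1" and J': "J' = {a'..<a' + int N}" and \<pi>: "\<pi> permutes J'" for N \<pi> J'
  proof -
    \<comment> \<open>The block of original terms on which all \<open>W i\<close> with
      \<open>i \<in> J'\<close> depend: the shared head followed by \<open>N\<close> individual
      terms.\<close>
    define J where "J = {a..<a' + d + int N}"
    define \<pi>' where "\<pi>' j = (if j < a' + d then j else \<pi> (j - d) + d)" for j
    have \<pi>': "\<pi>' permutes J"
      using permutes_shift_tail[OF \<pi>[unfolded J'] a] by (simp add: \<pi>'_def[abs_def] J_def)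
    have \<pi>J: "\<pi> i \<in> J'" if "i \<in> J'" for i
      using permutes_in_image[OF \<pi>] that by blast
    have mR: "(\<lambda>\<omega>. \<lambda>i\<in>J'. W i \<omega>) \<in> measurable M (PiM J' (\<lambda>_. K'))"
      using mW J' by (intro measurable_restrict) auto
    have mL: "(\<lambda>\<omega>. \<lambda>i\<in>J'. W (\<pi> i) \<omega>) \<in> measurable M (PiM J' (\<lambda>_. K'))"
      using mW \<pi>J J' by (intro measurable_restrict) auto
    interpret L: prob_space ?L by (rule prob_space_distr[OF mL])
    show ?thesis
    \<comment> \<open>Agreement on rectangles suffices, the whole space being itself a rectangle of
      finite mass.\<close>
    proof (rule measure_eqI_PiM_finite)
      show "range (\<lambda>_::nat. space (PiM J' (\<lambda>_. K'))) \<subseteq> prod_algebra J' (\<lambda>_. K')"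
        by (auto simp: space_PiM J' intro!: prod_algebraI_finite)
      show "?L (space (PiM J' (\<lambda>_. K'))) \<noteq> \<infinity>"
        by (simp add: L.emeasure_finite)
      fix A assume A: "\<And>i. i \<in> J' \<Longrightarrow> A i \<in> sets K'"
      \<comment> \<open>One set \<open>B i\<close> serves every index \<open>l\<close>; this is what
        lets a permutation act on the indices of \<open>W\<close> while the sets stay in
        place.\<close>
      have "\<forall>i\<in>J'. \<exists>B. B \<in> sets (PiM {a..<a' + d} (\<lambda>_. K) \<Otimes>\<^sub>M K) \<and> (\<forall>l\<ge>a'. \<forall>\<omega>\<in>space M.
          W l \<omega> \<in> A i \<longleftrightarrow> (\<lambda>j\<in>{a..<a' + d}. V j \<omega>, V (l + d) \<omega>) \<in> B)"
        using W A by (meson)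
      from bchoice[OF this] obtain B where B: "\<And>i. i \<in> J' \<Longrightarrow> B i \<in> sets (PiM {a..<a' + d} (\<lambda>_. K) \<Otimes>\<^sub>M K)"
        "\<And>i l \<omega>. i \<in> J' \<Longrightarrow> l \<ge> a' \<Longrightarrow> \<omega> \<in> space M \<Longrightarrow>
          W l \<omega> \<in> A i \<longleftrightarrow> (\<lambda>j\<in>{a..<a' + d}. V j \<omega>, V (l + d) \<omega>) \<in> B i"
        by metis
      define C where "C = {v \<in> space (PiM J (\<lambda>_. K)). \<forall>i\<in>J'. (restrict v {a..<a' + d}, v (i + d)) \<in> B i}"
      have C: "C \<in> sets (PiM J (\<lambda>_. K))"
        unfolding C_def
      proof (rule sets.sets_Collect_finite_All')
        fix i assume i: "i \<in> J'"
        have "(\<lambda>v. (restrict v {a..<a' + d}, v (i + d))) \<in>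
            measurable (PiM J (\<lambda>_. K)) (PiM {a..<a' + d} (\<lambda>_. K) \<Otimes>\<^sub>M K)"
          using i a by (intro measurable_Pair measurable_restrict_subset measurable_component_singleton)
            (auto simp: J_def J')
        from measurable_sets[OF this B(1)[OF i]]
        show "{v \<in> space (PiM J (\<lambda>_. K)). (restrict v {a..<a' + d}, v (i + d)) \<in> B i} \<in> sets (PiM J (\<lambda>_. K))"
          by (simp add: vimage_def Int_def conj_commute)
      qed (use N in \<open>auto simp: J'\<close>)
      \<comment> \<open>Used twice, for \<open>\<pi>'\<close> with \<open>\<pi>\<close> and for the
        two identities. As \<open>\<sigma>'\<close> fixes the head, moving the tail of
        \<open>V\<close> by \<open>\<sigma>'\<close> amounts to moving \<open>W\<close> by
        \<open>\<sigma>\<close>.\<close>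
      have CW: "{\<omega> \<in> space M. (\<lambda>i\<in>J. V (\<sigma>' i) \<omega>) \<in> C} =
          (\<lambda>\<omega>. \<lambda>i\<in>J'. W (\<sigma> i) \<omega>) -` (Pi\<^sub>E J' A) \<inter> space M"
        if s: "\<And>j. j < a' + d \<Longrightarrow> \<sigma>' j = j" "\<And>i. i \<in> J' \<Longrightarrow> \<sigma>' (i + d) = \<sigma> i + d" "\<sigma>' permutes J"
          "\<And>i. i \<in> J' \<Longrightarrow> \<sigma> i \<in> J'" for \<sigma> \<sigma>'
      proof -
        have "(\<lambda>i\<in>J. V (\<sigma>' i) \<omega>) \<in> space (PiM J (\<lambda>_. K))" if "\<omega> \<in> space M" for \<omega>
        proof -
          have "\<sigma>' i \<ge> a" if "i \<in> J" for i
            using permutes_in_image[OF s(3), of i] that by (simp add: J_def)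
          then have "V (\<sigma>' i) \<omega> \<in> space K" if "i \<in> J" for i
            using measurable_space[OF mV \<open>\<omega> \<in> space M\<close>] that by blast
          then show ?thesis
            by (simp add: space_PiM)
        qed
        moreover have "restrict (\<lambda>i\<in>J. V (\<sigma>' i) \<omega>) {a..<a' + d} = (\<lambda>j\<in>{a..<a' + d}. V j \<omega>)" for \<omega>
          using s(1) by (auto simp: J_def fun_eq_iff)
        moreover have "(\<lambda>i\<in>J. V (\<sigma>' i) \<omega>) (i + d) = V (\<sigma> i + d) \<omega>" if "i \<in> J'" for i \<omega>
          using that s(2) a by (auto simp: J_def J')
        moreover have "W (\<sigma> i) \<omega> \<in> A i \<longleftrightarrow> (\<lambda>j\<in>{a..<a' + d}. V j \<omega>, V (\<sigma> i + d) \<omega>) \<in> B i"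
          if "i \<in> J'" "\<omega> \<in> space M" for i \<omega>
          using that s(4)[OF that(1)] by (intro B(2)) (auto simp: J')
        ultimately show ?thesis
          by (auto simp: C_def PiE_iff extensional_def)
      qed
      have PE: "Pi\<^sub>E J' A \<in> sets (PiM J' (\<lambda>_. K'))"
        using A by (intro sets_PiM_I_finite) (auto simp: J')
      have "?L (Pi\<^sub>E J' A) = emeasure M {\<omega> \<in> space M. (\<lambda>i\<in>J. V (\<pi>' i) \<omega>) \<in> C}"
        unfolding emeasure_distr[OF mL PE]
        by (subst CW[of \<pi>' \<pi>]) (use \<pi>J \<pi>' in \<open>auto simp: \<pi>'_def J'\<close>)
      also have "\<dots> = emeasure M {\<omega> \<in> space M. (\<lambda>i\<in>J. V i \<omega>) \<in> C}"
        using N a by (intro exchangeable_emeasure_eq[OF V J_def _ \<pi>' C]) auto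
      also have "\<dots> = ?R (Pi\<^sub>E J' A)"
        unfolding emeasure_distr[OF mR PE]
        by (subst CW[of "\<lambda>i. i" "\<lambda>i. i"]) (use permutes_id[of J] in \<open>auto simp: id_def\<close>)
      finally show "?L (Pi\<^sub>E J' A) = ?R (Pi\<^sub>E J' A)" .
    qed (auto simp: J')
  qed
  show ?thesis
    unfolding exchangeable_def using mW eq by blast
qed

text \<open>The score \<open>i\<close> reads the observable \<open>i\<close> itself, hence the shift
  \<open>d = 0\<close>; the head is the training sample. By joint measurability,
  \<open>\<omega>\<close> enters otherwise only through the training sample.\<close>

lemma exchangeable_score:
  assumes M: "prob_space M"
    and V: "exchangeable M (observable_space \<Y>) (1 - int t) (\<lambda>i \<omega>. (X i \<omega>, Y i \<omega>))"
    and \<rho>: "jointly_measurable M \<Y> t X Y \<rho>"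
  shows "exchangeable M borel 1 (score X Y \<rho>)"
proof (rule exchangeable_transform[OF M V, where d = 0])
  let ?K = "observable_space \<Y>"
  let ?T = "\<lambda>\<omega>. \<lambda>i\<in>{1 - int t..0}. (X i \<omega>, Y i \<omega>)"
  let ?N = "PiM {1 - int t..0} (\<lambda>_. ?K)"
  have XY: "(X i \<omega>, Y i \<omega>) \<in> space ?K" if "i \<ge> 1 - int t" "\<omega> \<in> space M" for i \<omega>
    using V that by (auto simp: exchangeable_def dest: measurable_space)
  fix A :: "real set" assume A: "A \<in> sets borel"
  let ?D = "(\<lambda>((x, y), \<omega>). \<rho> x y \<omega>) -` A \<inter> space (?K \<Otimes>\<^sub>M training_algebra M \<Y> t X Y)"
  have D: "?D \<in> sets (?K \<Otimes>\<^sub>M vimage_algebra (space M) ?T ?N)"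
    using measurable_sets[OF \<rho>[unfolded jointly_measurable_def] A] by (simp add: training_algebra_def)
  have T: "?T \<in> space M \<rightarrow> space ?N"
    using XY by (auto simp: space_PiM)
  obtain B where B: "B \<in> sets (?N \<Otimes>\<^sub>M ?K)"
    "\<forall>x\<in>space ?K. \<forall>\<omega>\<in>space M. (x, \<omega>) \<in> ?D \<longleftrightarrow> (?T \<omega>, x) \<in> B"
    using sets_pair_vimage_algebra[OF T D] ..
  have "score X Y \<rho> i \<omega> \<in> A \<longleftrightarrow> (?T \<omega>, (X i \<omega>, Y i \<omega>)) \<in> B" if i: "i \<ge> 1" and \<omega>: "\<omega> \<in> space M" for i \<omega>
  proof -
    have xy: "(X i \<omega>, Y i \<omega>) \<in> space ?K"
      using i \<omega> by (intro XY) auto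
    have "score X Y \<rho> i \<omega> \<in> A \<longleftrightarrow> ((X i \<omega>, Y i \<omega>), \<omega>) \<in> ?D"
      using xy \<omega> by (simp add: score_def space_pair_measure training_algebra_def)
    also have "\<dots> \<longleftrightarrow> (?T \<omega>, (X i \<omega>, Y i \<omega>)) \<in> B"
      by (rule B(2)[rule_format, OF xy \<omega>])
    finally show ?thesis .
  qed
  then have "\<exists>B\<in>sets (?N \<Otimes>\<^sub>M ?K). \<forall>i\<ge>1. \<forall>\<omega>\<in>space M.
      score X Y \<rho> i \<omega> \<in> A \<longleftrightarrow> (?T \<omega>, (X i \<omega>, Y i \<omega>)) \<in> B"
    using B(1) by blast
  moreover have "{1 - int t..0} = {1 - int t..<1}"
    by auto
  ultimately show "\<exists>B\<in>sets (PiM {1 - int t..<1 + 0} (\<lambda>_. ?K) \<Otimes>\<^sub>M ?K). \<forall>i\<ge>1. \<forall>\<omega>\<in>space M.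
      score X Y \<rho> i \<omega> \<in> A \<longleftrightarrow>
      (\<lambda>j\<in>{1 - int t..<1 + 0}. (X j \<omega>, Y j \<omega>), (X (i + 0) \<omega>, Y (i + 0) \<omega>)) \<in> B"
    by (simp only: add_0_right)
qed auto

subsection \<open>Ranks and order statistics\<close>

text \<open>Sorting preserves the number of entries below \<open>x\<close>, and these form an
  initial segment of the sorted list. From here on, counts of strict comparisons replace order
  statistics.\<close>

lemma order_statistic_ge_iff:
  assumes b: "1 \<le> b" "b \<le> n"
  shows "x \<le> order_statistic n s b \<longleftrightarrow> card {i \<in> {1..int n}. s i < x} < b"
proof -
  let ?ys = "sort (map s [1..int n])"
  have len: "length ?ys = n"
    by simp
  have c: "card {k. k < n \<and> ?ys ! k < x} = card {i \<in> {1..int n}. s i < x}"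
  proof -
    have "card {k. k < n \<and> ?ys ! k < x} = length (filter (\<lambda>y. y < x) ?ys)"
      by (simp add: length_filter_conv_card)
    also have "\<dots> = length (filter (\<lambda>y. y < x) (map s [1..int n]))"
      by (metis mset_filter mset_sort size_mset)
    also have "\<dots> = length (filter (\<lambda>i. s i < x) [1..int n])"
      by (simp add: filter_map comp_def)
    also have "\<dots> = card (set (filter (\<lambda>i. s i < x) [1..int n]))"
      by (intro distinct_card[symmetric] distinct_filter) simp
    also have "set (filter (\<lambda>i. s i < x) [1..int n]) = {i \<in> {1..int n}. s i < x}"
      by auto
    finally show ?thesis .
  qed
  have mono: "?ys ! k \<le> ?ys ! l" if "k \<le> l" "l < n" for k l
    using that len by (intro sorted_nth_mono) auto
  show ?thesis
  \<comment> \<open>Positions start at 0, so the \<open>b\<close>-th smallest entry sits at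
    \<open>b - 1\<close>. If it is at least \<open>x\<close>, only the \<open>b - 1\<close>
    positions before it can hold smaller entries; otherwise the first \<open>b\<close> positions all
    do.\<close>
  proof (cases "x \<le> ?ys ! (b - 1)")
    case True
    have "{k. k < n \<and> ?ys ! k < x} \<subseteq> {..<b - 1}"
    proof
      fix k assume k: "k \<in> {k. k < n \<and> ?ys ! k < x}"
      have "\<not> b - 1 \<le> k"
        using mono[of "b - 1" k] k True by force
      then show "k \<in> {..<b - 1}" by simp
    qed
    then have "card {k. k < n \<and> ?ys ! k < x} \<le> b - 1"
      using card_mono[of "{..<b - 1}"] by fastforce
    with True b c show ?thesis
      by (simp add: order_statistic_def)
  next
    case False
    have "{..<b} \<subseteq> {k. k < n \<and> ?ys ! k < x}"
    proof
      fix k assume k: "k \<in> {..<b}"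
      then have "?ys ! k \<le> ?ys ! (b - 1)"
        using b by (intro mono) auto
      with False k b show "k \<in> {k. k < n \<and> ?ys ! k < x}" by auto
    qed
    then have "b \<le> card {k. k < n \<and> ?ys ! k < x}"
      using card_mono[of "{k. k < n \<and> ?ys ! k < x}" "{..<b}"] by simp
    with False c show ?thesis
      by (simp add: order_statistic_def)
  qed
qed

text \<open>Strictness is witnessed by \<open>i\<close>, which is counted below \<open>j\<close> but
  not below itself.\<close>

lemma rank_less:
  assumes "finite I" "i \<in> I" "(s :: 'a \<Rightarrow> real) i < s j"
  shows "card {l \<in> I. s l < s i} < card {l \<in> I. s l < s j}"
proof (rule psubset_card_mono)
  show "{l \<in> I. s l < s i} \<subset> {l \<in> I. s l < s j}"
  proof (rule psubsetI)
    show "{l \<in> I. s l < s i} \<subseteq> {l \<in> I. s l < s j}"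
      using assms(3) by auto
    have "i \<notin> {l \<in> I. s l < s i}" "i \<in> {l \<in> I. s l < s j}"
      using assms(2,3) by simp_all
    then show "{l \<in> I. s l < s i} \<noteq> {l \<in> I. s l < s j}"
      by metis
  qed
qed (use assms(1) in simp)

lemma rank_eq_imp_eq:
  assumes "finite I" "inj_on (s :: 'a \<Rightarrow> real) I" "i \<in> I" "j \<in> I"
    and "card {l \<in> I. s l < s i} = card {l \<in> I. s l < s j}"
  shows "i = j"
proof (rule inj_onD[OF assms(2) _ assms(3,4)], rule ccontr)
  assume "s i \<noteq> s j"
  then consider "s i < s j" | "s j < s i"
    by linarith
  then show False
    using rank_less[OF assms(1,3), of s j] rank_less[OF assms(1,4), of s i] assms(5) by cases simp_all
qed

text \<open>Pigeonhole: without ties the rank is an injection from \<open>I\<close> into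
  \<open>{..<card I}\<close>, hence onto.\<close>

lemma rank_exists:
  assumes I: "finite I" "inj_on (s :: 'a \<Rightarrow> real) I" and r: "r < card I"
  obtains j where "j \<in> I" "card {i \<in> I. s i < s j} = r"
proof -
  let ?f = "\<lambda>j. card {i \<in> I. s i < s j}"
  have "inj_on ?f I"
    using rank_eq_imp_eq[OF I] by (auto intro: inj_onI)
  then have "card (?f ` I) = card {..<card I}"
    by (simp add: card_image)
  moreover have "?f ` I \<subseteq> {..<card I}"
    using I(1) by (auto intro!: psubset_card_mono)
  ultimately have "?f ` I = {..<card I}"
    by (intro card_subset_eq) auto
  with r have "r \<in> ?f ` I"
    by simp
  with that show thesis
    by blast
qed

text \<open>The only candidate for \<open>j\<close> is the index of the \<open>b\<close>-th smallest
  calibration score, and the only candidate for \<open>A\<close> is the set of all indices with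
  scores below \<open>s j\<close>. The part of \<open>A\<close> outside \<open>I\<close> then
  consists of the covered future indices.\<close>

lemma coverage_count_iff:
  fixes s :: "int \<Rightarrow> real" and n m b k :: nat
  defines "J \<equiv> {1..<1 + int (n + m)}" and "I \<equiv> {1..int n}"
  assumes inj: "inj_on s J" and b: "1 \<le> b" "b \<le> n"
  shows "card {i \<in> {1..int m}. card {l \<in> I. s l < s (int n + i)} < b} = k \<longleftrightarrow>
    (\<exists>j\<in>I. \<exists>A. A \<subseteq> J - {j} \<and> card (A \<inter> I) = b - 1 \<and> card (A - I) = k \<and> (\<forall>i\<in>J. s i < s j \<longleftrightarrow> i \<in> A))"
proof -
  have IJ: "I \<subseteq> J" "finite I" "finite J"
    by (auto simp: I_def J_def)
  have injI: "inj_on s I"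
    using inj IJ(1) by (rule inj_on_subset)
  have "b - 1 < card I"
    using b by (simp add: I_def)
  then obtain j where j: "j \<in> I" "card {i \<in> I. s i < s j} = b - 1"
    by (rule rank_exists[OF IJ(2) injI])
  \<comment> \<open>A future score cannot tie with \<open>s j\<close>. If it lies above, then
    \<open>j\<close> and the \<open>b - 1\<close> calibration indices below \<open>j\<close> are all
    counted, which is one too many.\<close>
  have lt: "card {l \<in> I. s l < s (int n + i)} < b \<longleftrightarrow> s (int n + i) < s j" if i: "i \<in> {1..int m}" for i
  proof
    assume l: "s (int n + i) < s j"
    have "card {l \<in> I. s l < s (int n + i)} \<le> card {l \<in> I. s l < s j}"
      using l IJ by (intro card_mono) auto
    with j b show "card {l \<in> I. s l < s (int n + i)} < b"
      by simp
  next
    assume l: "card {l \<in> I. s l < s (int n + i)} < b"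
    have ne: "s (int n + i) \<noteq> s j"
      using inj_onD[OF inj, of "int n + i" j] i j(1) by (auto simp: I_def J_def)
    show "s (int n + i) < s j"
    proof (rule ccontr)
      assume "\<not> s (int n + i) < s j"
      with ne have "s j < s (int n + i)" by simp
      from rank_less[OF IJ(2) j(1) this] l j(2) b show False by simp
    qed
  qed
  have "card {i \<in> {1..int m}. card {l \<in> I. s l < s (int n + i)} < b} = card {i \<in> {1..int m}. s (int n + i) < s j}"
    using lt by (intro arg_cong[of _ _ card]) blast
  also have "\<dots> = card ((+) (int n) ` {i \<in> {1..int m}. s (int n + i) < s j})"
    by (intro card_image[symmetric]) (auto intro: inj_onI)
  \<comment> \<open>Passes from positions \<open>1..m\<close> within the batch to indices in the
    whole sequence.\<close>
  also have "(+) (int n) ` {i \<in> {1..int m}. s (int n + i) < s j} = {i \<in> J. s i < s j} - I"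
  proof (intro equalityI subsetI)
    fix x assume x: "x \<in> {i \<in> J. s i < s j} - I"
    then have "x = int n + (x - int n)" "x - int n \<in> {i \<in> {1..int m}. s (int n + i) < s j}"
      by (auto simp: I_def J_def)
    then show "x \<in> (+) (int n) ` {i \<in> {1..int m}. s (int n + i) < s j}"
      by (rule image_eqI)
  qed (auto simp: I_def J_def)
  finally have count: "card {i \<in> {1..int m}. card {l \<in> I. s l < s (int n + i)} < b} =
    card ({i \<in> J. s i < s j} - I)" .
  have below: "{i \<in> J. s i < s j'} \<inter> I = {i \<in> I. s i < s j'}" for j'
    using IJ(1) by auto
  show ?thesis
    unfolding count
  proof
    assume "card ({i \<in> J. s i < s j} - I) = k"
    then show "\<exists>j\<in>I. \<exists>A. A \<subseteq> J - {j} \<and> card (A \<inter> I) = b - 1 \<and> card (A - I) = k \<and> (\<forall>i\<in>J. s i < s j \<longleftrightarrow> i \<in> A)"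
      using j below[of j] by (intro bexI[of _ j] exI[of _ "{i \<in> J. s i < s j}"]) auto
  next
    assume "\<exists>j\<in>I. \<exists>A. A \<subseteq> J - {j} \<and> card (A \<inter> I) = b - 1 \<and> card (A - I) = k \<and> (\<forall>i\<in>J. s i < s j \<longleftrightarrow> i \<in> A)"
    then obtain j' A where A: "j' \<in> I" "A \<subseteq> J - {j'}" "card (A \<inter> I) = b - 1" "card (A - I) = k"
      "\<forall>i\<in>J. s i < s j' \<longleftrightarrow> i \<in> A" by blast
    \<comment> \<open>The membership condition forces \<open>A\<close>; its calibration part then
      gives \<open>j'\<close> the same rank as \<open>j\<close>.\<close>
    have AJ: "A = {i \<in> J. s i < s j'}"
      using A(2,5) by blast
    then have "card {i \<in> I. s i < s j'} = b - 1"
      using A(3) below[of j'] by simp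
    with j A(1) have "j' = j"
      using rank_eq_imp_eq[OF IJ(2) injI, of j' j] by simp
    with AJ A(4) show "card ({i \<in> J. s i < s j} - I) = k" by simp
  qed
qed

section \<open>Counting and moving pairs of an index and a subset\<close>

text \<open>A subset of a disjoint union is a pair of subsets of the two parts, with union as the
  inverse map.\<close>

lemma card_split_subsets:
  assumes "finite U" "finite W" "U \<inter> W = {}"
  shows "card {A. A \<subseteq> U \<union> W \<and> card (A \<inter> U) = p \<and> card (A \<inter> W) = q} = (card U choose p) * (card W choose q)"
proof -
  have "card {A. A \<subseteq> U \<union> W \<and> card (A \<inter> U) = p \<and> card (A \<inter> W) = q} =
      card ({A. A \<subseteq> U \<and> card A = p} \<times> {A. A \<subseteq> W \<and> card A = q})"
  proof (rule bij_betw_same_card[of "\<lambda>A. (A \<inter> U, A \<inter> W)"], rule bij_betw_byWitness[where f' = "\<lambda>(A, B). A \<union> B"])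
    show "(\<lambda>(A, B). A \<union> B) ` ({A. A \<subseteq> U \<and> card A = p} \<times> {A. A \<subseteq> W \<and> card A = q})
        \<subseteq> {A. A \<subseteq> U \<union> W \<and> card (A \<inter> U) = p \<and> card (A \<inter> W) = q}"
    proof (clarsimp, intro conjI)
      fix A B assume "A \<subseteq> U" "B \<subseteq> W"
      then have "(A \<union> B) \<inter> U = A" "(A \<union> B) \<inter> W = B"
        using assms(3) by auto
      then show "card ((A \<union> B) \<inter> U) = card A" "card ((A \<union> B) \<inter> W) = card B"
        by simp_all
    qed auto
  qed (use assms(3) in auto)
  then show ?thesis
    using assms by (simp add: card_cartesian_product n_subsets)
qed

text \<open>Three bijections between blocks of equal size are glued: \<open>A\<close> to
  \<open>A'\<close>, \<open>j\<close> to \<open>j'\<close>, remainder to remainder. Through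
  exchangeability this makes events with equal \<open>card A\<close> equally likely.\<close>

lemma permutes_obtain:
  assumes J: "finite J" and j: "j \<in> J" "A \<subseteq> J - {j}" and j': "j' \<in> J" "A' \<subseteq> J - {j'}" and c: "card A = card A'"
  obtains \<pi> where "\<pi> permutes J" "\<pi> j = j'" "\<pi> ` A = A'"
proof -
  have fin: "finite A" "finite A'"
    using J j j' by (auto intro: finite_subset)
  obtain f where f: "bij_betw f A A'"
    using finite_same_card_bij[OF fin c] by blast
  have "card (J - insert j A) = card (J - insert j' A')"
    using J j j' fin c by (subst (1 2) card_Diff_subset) (auto simp: card_insert_if subset_Diff_insert)
  then obtain h where h: "bij_betw h (J - insert j A) (J - insert j' A')"
    using finite_same_card_bij J by (meson finite_Diff)
  define \<pi> where "\<pi> x = (if x \<in> A then f x else if x = j then j' else if x \<in> J then h x else x)" for x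
  have 1: "bij_betw \<pi> A A'"
    using f by (rule bij_betw_cong[THEN iffD1, rotated]) (auto simp: \<pi>_def)
  have 2: "bij_betw \<pi> {j} {j'}"
    using j by (auto simp: \<pi>_def bij_betw_def)
  have 3: "bij_betw \<pi> (J - insert j A) (J - insert j' A')"
    using h by (rule bij_betw_cong[THEN iffD1, rotated]) (auto simp: \<pi>_def)
  have "bij_betw \<pi> (A \<union> {j} \<union> (J - insert j A)) (A' \<union> {j'} \<union> (J - insert j' A'))"
    using 1 2 3 j' by (intro bij_betw_combine) auto
  moreover have "A \<union> {j} \<union> (J - insert j A) = J" "A' \<union> {j'} \<union> (J - insert j' A') = J"
    using j j' by auto
  ultimately have "\<pi> permutes J"
    using j by (intro bij_imp_permutes) (auto simp: \<pi>_def)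
  moreover have "\<pi> j = j'" "\<pi> ` A = A'"
    using j 1 by (auto simp: \<pi>_def bij_betw_def)
  ultimately show thesis by (rule that)
qed

subsection \<open>Relative ranks of exchangeable scores\<close>

text \<open>The set takes finitely many values \<open>G\<close>, each described by finitely many
  measurable conditions, so \<open>Q\<close> may be arbitrary.\<close>

lemma pred_Collect_finite:
  assumes F: "finite F" and P: "\<And>l. l \<in> F \<Longrightarrow> Measurable.pred M (P l)"
  shows "Measurable.pred M (\<lambda>x. Q {l \<in> F. P l x})"
proof -
  have "Q {l \<in> F. P l x} \<longleftrightarrow> (\<exists>G\<in>Pow F. Q G \<and> (\<forall>l\<in>F. P l x \<longleftrightarrow> l \<in> G))" for x
  proof
    assume "Q {l \<in> F. P l x}"
    then show "\<exists>G\<in>Pow F. Q G \<and> (\<forall>l\<in>F. P l x \<longleftrightarrow> l \<in> G)"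
      by (intro bexI[of _ "{l \<in> F. P l x}"]) auto
  next
    assume "\<exists>G\<in>Pow F. Q G \<and> (\<forall>l\<in>F. P l x \<longleftrightarrow> l \<in> G)"
    then obtain G where G: "G \<subseteq> F" "Q G" "\<forall>l\<in>F. P l x \<longleftrightarrow> l \<in> G"
      by blast
    then have "{l \<in> F. P l x} = G"
      by blast
    with G(2) show "Q {l \<in> F. P l x}"
      by simp
  qed
  moreover have "Measurable.pred M (\<lambda>x. \<exists>G\<in>Pow F. Q G \<and> (\<forall>l\<in>F. P l x \<longleftrightarrow> l \<in> G))"
    using F P by (intro pred_intros_finite pred_intros_logic) auto
  ultimately show ?thesis
    by simp
qed

text \<open>Absence of ties is built in, so that the events for different pairs with sets of equal
  size are disjoint outright and not merely up to a null set.\<close>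

definition lower_set_at :: "'i set \<Rightarrow> ('i \<Rightarrow> real) \<Rightarrow> 'i \<Rightarrow> 'i set \<Rightarrow> bool" where
  "lower_set_at J s j A \<longleftrightarrow> inj_on s J \<and> (\<forall>i\<in>J. s i < s j \<longleftrightarrow> i \<in> A)"

lemma lower_set_at_cong:
  "(\<And>i. i \<in> J \<Longrightarrow> s i = s' i) \<Longrightarrow> j \<in> J \<Longrightarrow> lower_set_at J s j A \<longleftrightarrow> lower_set_at J s' j A"
  by (simp add: lower_set_at_def cong: inj_on_cong)

text \<open>The quantifier over \<open>J\<close> absorbs \<open>\<pi>\<close>, which maps
  \<open>J\<close> onto itself injectively.\<close>

lemma lower_set_at_permute:
  assumes \<pi>: "\<pi> permutes J"
  shows "lower_set_at J (\<lambda>i. s (\<pi> i)) j A \<longleftrightarrow> lower_set_at J s (\<pi> j) (\<pi> ` A)"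
proof -
  have im: "\<pi> ` J = J" and inj: "inj \<pi>"
    using \<pi> by (simp_all add: permutes_image permutes_inj)
  have "inj_on (\<lambda>i. s (\<pi> i)) J \<longleftrightarrow> inj_on s (\<pi> ` J)"
    using comp_inj_on_iff[OF inj_on_subset[OF inj subset_UNIV], of s] by (simp add: comp_def)
  moreover have "(\<forall>i\<in>J. s (\<pi> i) < s (\<pi> j) \<longleftrightarrow> i \<in> A) \<longleftrightarrow> (\<forall>i\<in>\<pi> ` J. s i < s (\<pi> j) \<longleftrightarrow> i \<in> \<pi> ` A)"
    using inj by (simp add: inj_image_mem_iff)
  ultimately show ?thesis
    by (simp add: lower_set_at_def im)
qed

text \<open>The size of \<open>A\<close> is the rank of \<open>j\<close>, and without ties the rank
  determines the index.\<close>

lemma lower_set_at_unique: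
  assumes J: "finite J" "j \<in> J" "j' \<in> J" and A: "A \<subseteq> J" "A' \<subseteq> J" "card A = card A'"
    and l: "lower_set_at J s j A" "lower_set_at J s j' A'"
  shows "j = j'" "A = A'"
proof -
  have e: "A = {i \<in> J. s i < s j}" "A' = {i \<in> J. s i < s j'}"
    using A l by (auto simp: lower_set_at_def)
  show "j = j'"
    using J A(3) l unfolding e by (intro rank_eq_imp_eq[of J s]) (auto simp: lower_set_at_def)
  with e show "A = A'"
    by simp
qed

section \<open>Probabilities of the relative-rank events\<close>

locale exchangeable_scores = prob_space M for M :: "'w measure" +
  fixes S :: "int \<Rightarrow> 'w \<Rightarrow> real"
  assumes exch: "exchangeable M borel 1 S"
    and no_ties: "AE \<omega> in M. inj_on (\<lambda>i. S i \<omega>) {1..}"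
begin

lemma S_measurable: "i \<ge> 1 \<Longrightarrow> S i \<in> borel_measurable M"
  using exch by (simp add: exchangeable_def)

lemma pred_S_less: "i \<ge> 1 \<Longrightarrow> j \<ge> 1 \<Longrightarrow> Measurable.pred M (\<lambda>\<omega>. S i \<omega> < S j \<omega>)"
  using S_measurable by (intro borel_measurable_pred_less)

lemma pred_lower_set_at:
  assumes J: "finite J" "J \<subseteq> {1..}" and j: "j \<in> J"
  shows "Measurable.pred M (\<lambda>\<omega>. lower_set_at J (\<lambda>i. S i \<omega>) j A)"
proof -
  have "Measurable.pred M (\<lambda>\<omega>. S i \<omega> = S l \<omega>)" if "i \<in> J" "l \<in> J" for i l
    using that J S_measurable[of i] S_measurable[of l] unfolding pred_def by (intro borel_measurable_eq) auto
  then show ?thesis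
    unfolding lower_set_at_def inj_on_def using J j
    by (intro pred_intros_finite pred_intros_logic pred_S_less) auto
qed

text \<open>Take \<open>\<pi>\<close> carrying \<open>(j, A)\<close> to \<open>(j', A')\<close>. The
  event for \<open>(j, A)\<close>, evaluated at the scores permuted by \<open>\<pi>\<close>, is the
  event for \<open>(j', A')\<close>.\<close>

lemma prob_lower_set_at_eq:
  assumes J: "J = {1..<1 + int N}" and j: "j \<in> J" "A \<subseteq> J - {j}" and j': "j' \<in> J" "A' \<subseteq> J - {j'}"
    and c: "card A = card A'"
  shows "prob {\<omega> \<in> space M. lower_set_at J (\<lambda>i. S i \<omega>) j A} =
    prob {\<omega> \<in> space M. lower_set_at J (\<lambda>i. S i \<omega>) j' A'}"
proof -
  have fin: "finite J" and N: "1 < 1 + int N"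
    using J j by auto
  obtain \<pi> where \<pi>: "\<pi> permutes J" "\<pi> j = j'" "\<pi> ` A = A'"
    by (rule permutes_obtain[OF fin j j' c])
  \<comment> \<open>The event as a measurable set of score vectors, the form to which
    exchangeability applies.\<close>
  define C where "C = {v \<in> space (PiM J (\<lambda>_. borel)). lower_set_at J v j A}"
  have comp[measurable]: "(\<lambda>v. v i) \<in> borel_measurable (PiM J (\<lambda>_. borel :: real measure))" if "i \<in> J" for i
    using that by (rule measurable_component_singleton)
  have "Measurable.pred (PiM J (\<lambda>_. borel)) (\<lambda>v. lower_set_at J v j A)"
    unfolding lower_set_at_def inj_on_def using fin j
    by (intro pred_intros_finite pred_intros_logic) (auto simp: pred_def intro!: borel_measurable_less borel_measurable_eq)
  then have C: "C \<in> sets (PiM J (\<lambda>_. borel))"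
    by (simp add: C_def pred_def)
  have "(\<lambda>i\<in>J. S (\<sigma> i) \<omega>) \<in> C \<longleftrightarrow> lower_set_at J (\<lambda>i. S (\<sigma> i) \<omega>) j A" for \<sigma> \<omega>
    using lower_set_at_cong[of J "\<lambda>i\<in>J. S (\<sigma> i) \<omega>" "\<lambda>i. S (\<sigma> i) \<omega>" j A] j(1) by (simp add: C_def space_PiM)
  then show ?thesis
    using exchangeable_emeasure_eq[OF exch J N \<pi>(1) C]
    by (simp add: measure_def lower_set_at_permute[OF \<pi>(1), of "\<lambda>i. S i _"] \<pi>(2,3))
qed

text \<open>All sets in \<open>Q\<close> have size \<open>r\<close>, so the events are disjoint and
  equally likely. The pair \<open>(j, A)\<close> only supplies the common value and may lie outside
  \<open>Q\<close>.\<close>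

lemma prob_Union_lower_set_at:
  assumes J: "J = {1..<1 + int N}" and Q: "Q \<subseteq> (SIGMA j:J. {A. A \<subseteq> J - {j} \<and> card A = r})"
    and j: "j \<in> J" "A \<subseteq> J - {j}" "card A = r"
  shows "prob {\<omega> \<in> space M. \<exists>(i, B)\<in>Q. lower_set_at J (\<lambda>i. S i \<omega>) i B} =
    real (card Q) * prob {\<omega> \<in> space M. lower_set_at J (\<lambda>i. S i \<omega>) j A}"
proof -
  let ?E = "\<lambda>p. {\<omega> \<in> space M. lower_set_at J (\<lambda>i. S i \<omega>) (fst p) (snd p)}"
  have fin: "finite J" "J \<subseteq> {1..}"
    using J by auto
  have "finite (SIGMA j:J. {A. A \<subseteq> J - {j} \<and> card A = r})"
    using fin by (intro finite_SigmaI) auto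
  then have finQ: "finite Q"
    using Q by (rule finite_subset[rotated])
  have Q': "fst p \<in> J" "snd p \<subseteq> J - {fst p}" "card (snd p) = r" if "p \<in> Q" for p
    using subsetD[OF Q that] by (auto simp: mem_Sigma_iff split_beta)
  have "{\<omega> \<in> space M. \<exists>(i, B)\<in>Q. lower_set_at J (\<lambda>i. S i \<omega>) i B} = (\<Union>p\<in>Q. ?E p)"
    by auto
  also have "prob \<dots> = (\<Sum>p\<in>Q. prob (?E p))"
  proof (rule finite_measure_finite_Union[OF finQ])
    show "?E ` Q \<subseteq> events"
      using pred_lower_set_at[OF fin] Q'(1) by (auto simp: pred_def)
    show "disjoint_family_on ?E Q"
    proof (unfold disjoint_family_on_def, intro ballI impI, rule ccontr)
      fix p q assume pq: "p \<in> Q" "q \<in> Q" "p \<noteq> q" "?E p \<inter> ?E q \<noteq> {}"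
      then obtain \<omega> where l: "lower_set_at J (\<lambda>i. S i \<omega>) (fst p) (snd p)"
        "lower_set_at J (\<lambda>i. S i \<omega>) (fst q) (snd q)"
        by blast
      have "fst p = fst q" "snd p = snd q"
        using Q'[OF pq(1)] Q'[OF pq(2)] lower_set_at_unique[OF fin(1) _ _ _ _ _ l] by auto
      with pq(3) show False
        by (simp add: prod_eq_iff)
    qed
  qed
  also have "\<dots> = (\<Sum>p\<in>Q. prob {\<omega> \<in> space M. lower_set_at J (\<lambda>i. S i \<omega>) j A})"
    using Q' j by (intro sum.cong refl prob_lower_set_at_eq[OF J]) auto
  finally show ?thesis
    by simp
qed

lemma AE_inj: "J \<subseteq> {1..} \<Longrightarrow> AE \<omega> in M. inj_on (\<lambda>i. S i \<omega>) J"
  using no_ties by eventually_elim (rule inj_on_subset)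

text \<open>Almost surely some index has rank \<open>card A\<close>, so the events for all pairs
  with sets of that size exhaust the space. There are \<open>N\<close> choices of the index and then
  \<open>N - 1 choose card A\<close> of the set.\<close>

lemma prob_lower_set_at:
  assumes J: "J = {1..<1 + int N}" and j: "j \<in> J" "A \<subseteq> J - {j}"
  shows "real (N * (N - 1 choose card A)) * prob {\<omega> \<in> space M. lower_set_at J (\<lambda>i. S i \<omega>) j A} = 1"
proof -
  let ?P = "SIGMA j:J. {B. B \<subseteq> J - {j} \<and> card B = card A}"
  have fin: "finite J" "J \<subseteq> {1..}" "card J = N"
    using J by auto
  have "card A \<le> card (J - {j})"
    using fin j by (intro card_mono) auto
  \<comment> \<open>Strict because \<open>j\<close> is left out of \<open>A\<close>;
    \<open>rank_exists\<close> requires it.\<close>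
  then have r: "card A < card J"
    using fin(1) j(1) card_gt_0_iff[of J] by auto
  have "card ?P = (\<Sum>j\<in>J. card (J - {j}) choose card A)"
    using fin(1) by (subst card_SigmaI) (auto simp: n_subsets)
  also have "\<dots> = N * (N - 1 choose card A)"
    using fin by simp
  finally have "real (N * (N - 1 choose card A)) * prob {\<omega> \<in> space M. lower_set_at J (\<lambda>i. S i \<omega>) j A} =
      prob {\<omega> \<in> space M. \<exists>(i, B)\<in>?P. lower_set_at J (\<lambda>i. S i \<omega>) i B}"
    using prob_Union_lower_set_at[OF J subset_refl j refl] by simp
  also have "\<dots> = 1"
  proof (rule prob_Collect_eq_1[THEN iffD2])
    have "finite ?P"
      using fin by (intro finite_SigmaI) auto
    then show "{\<omega> \<in> space M. \<exists>(i, B)\<in>?P. lower_set_at J (\<lambda>i. S i \<omega>) i B} \<in> events"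
      unfolding pred_def[symmetric] using pred_lower_set_at[OF fin(1,2)] by (intro pred_intros_finite) auto
    show "AE \<omega> in M. \<exists>(i, B)\<in>?P. lower_set_at J (\<lambda>i. S i \<omega>) i B"
      using AE_inj[OF fin(2)]
    proof eventually_elim
      case (elim \<omega>)
      obtain i where i: "i \<in> J" "card {l \<in> J. S l \<omega> < S i \<omega>} = card A"
        using rank_exists[OF fin(1) elim r] by blast
      then show ?case
        using elim by (intro bexI[of _ "(i, {l \<in> J. S l \<omega> < S i \<omega>})"]) (auto simp: lower_set_at_def)
    qed
  qed
  finally show ?thesis .
qed

text \<open>The probability is the number of favourable pairs over the number of all pairs with sets
  of size \<open>b - 1 + k\<close>. The term \<open>n - b\<close> will be \<open>g - 1\<close> in
  the final formula.\<close>

lemma prob_coverage_count: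
  assumes b: "1 \<le> b" "b \<le> n" and k: "k \<le> m"
  shows "prob {\<omega> \<in> space M. card {i \<in> {1..int m}. card {l \<in> {1..int n}. S l \<omega> < S (int n + i) \<omega>} < b} = k} =
    real (m choose k) * (fact n * fact (k + b - 1) * fact (m - k + (n - b))) /
      (fact (b - 1) * fact (n - b) * fact (m + n))"
    (is "prob ?E = _")
proof -
  let ?I = "{1..int n}"
  define J where "J = {1..<1 + int (n + m)}"
  \<comment> \<open>The favourable pairs: \<open>j\<close> is the \<open>b\<close>-th smallest in
    the calibration sample and has exactly \<open>k\<close> future indices below it.\<close>
  define Q where "Q = (SIGMA j:?I. {A. A \<subseteq> J - {j} \<and> card (A \<inter> ?I) = b - 1 \<and> card (A - ?I) = k})"
  have fin: "finite J" "J \<subseteq> {1..}" "?I \<subseteq> J"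
    by (auto simp: J_def)
  then have card_rest: "card (J - ?I) = m"
    by (subst card_Diff_subset) (auto simp: J_def)
  have cardA: "card A = b - 1 + k" if "A \<subseteq> J - {j}" "card (A \<inter> ?I) = b - 1" "card (A - ?I) = k" for j A
    using that card_Int_Diff[of A ?I] finite_subset[of A J] fin(1) by auto
  have Qsub: "Q \<subseteq> (SIGMA j:J. {A. A \<subseteq> J - {j} \<and> card A = b - 1 + k})"
    using fin(3) cardA by (auto simp: Q_def)
  have cardQ: "card Q = n * ((n - 1 choose (b - 1)) * (m choose k))"
  proof -
    have "card {A. A \<subseteq> J - {j} \<and> card (A \<inter> ?I) = b - 1 \<and> card (A - ?I) = k} = (n - 1 choose (b - 1)) * (m choose k)"
      if j: "j \<in> ?I" for j
    proof -
      have "{A. A \<subseteq> J - {j} \<and> card (A \<inter> ?I) = b - 1 \<and> card (A - ?I) = k} =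
          {A. A \<subseteq> (?I - {j}) \<union> (J - ?I) \<and> card (A \<inter> (?I - {j})) = b - 1 \<and> card (A \<inter> (J - ?I)) = k}"
      proof (rule Collect_cong)
        fix A
        have "J - {j} = (?I - {j}) \<union> (J - ?I)"
          using j fin(3) by blast
        moreover have "A \<inter> ?I = A \<inter> (?I - {j})" "A - ?I = A \<inter> (J - ?I)" if "A \<subseteq> J - {j}"
          using that by blast+
        ultimately show "A \<subseteq> J - {j} \<and> card (A \<inter> ?I) = b - 1 \<and> card (A - ?I) = k \<longleftrightarrow>
          A \<subseteq> (?I - {j}) \<union> (J - ?I) \<and> card (A \<inter> (?I - {j})) = b - 1 \<and> card (A \<inter> (J - ?I)) = k"
          by metis
      qed
      also have "card \<dots> = (card (?I - {j}) choose (b - 1)) * (card (J - ?I) choose k)"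
        using fin by (intro card_split_subsets) auto
      finally show ?thesis
        using j card_rest by simp
    qed
    then show ?thesis
      unfolding Q_def using fin(1) by (subst card_SigmaI) auto
  qed
  \<comment> \<open>Nonemptiness provides a reference pair for the common probability.\<close>
  then have "card Q > 0"
    using b k by auto
  then have "Q \<noteq> {}"
    by auto
  then obtain j A where jA: "(j, A) \<in> Q"
    by fast
  then have j: "j \<in> J" "A \<subseteq> J - {j}" "card A = b - 1 + k"
    using Qsub by auto
  have finQ: "finite Q"
    using \<open>card Q > 0\<close> by (rule card_ge_0_finite)
  have "prob ?E = prob {\<omega> \<in> space M. \<exists>(i, B)\<in>Q. lower_set_at J (\<lambda>i. S i \<omega>) i B}"
  proof (rule finite_measure_eq_AE)
    show "AE \<omega> in M. \<omega> \<in> ?E \<longleftrightarrow> \<omega> \<in> {\<omega> \<in> space M. \<exists>(i, B)\<in>Q. lower_set_at J (\<lambda>i. S i \<omega>) i B}"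
      using AE_inj[OF fin(2)]
    proof eventually_elim
      case (elim \<omega>)
      have "card {i \<in> {1..int m}. card {l \<in> ?I. S l \<omega> < S (int n + i) \<omega>} < b} = k \<longleftrightarrow>
          (\<exists>(i, B)\<in>Q. lower_set_at J (\<lambda>i. S i \<omega>) i B)"
        using elim coverage_count_iff[OF elim[unfolded J_def] b]
        by (auto simp: lower_set_at_def Q_def J_def)
      then show ?case
        by simp
    qed
    show "?E \<in> events"
      unfolding pred_def[symmetric] by (intro pred_Collect_finite pred_S_less) auto
    show "{\<omega> \<in> space M. \<exists>(i, B)\<in>Q. lower_set_at J (\<lambda>i. S i \<omega>) i B} \<in> events"
      unfolding pred_def[symmetric] using finQ Qsub pred_lower_set_at[OF fin(1,2)]
      by (intro pred_intros_finite) auto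
  qed
  also have "\<dots> = real (card Q) * prob {\<omega> \<in> space M. lower_set_at J (\<lambda>i. S i \<omega>) j A}"
    by (rule prob_Union_lower_set_at[OF J_def Qsub j])
  also have "\<dots> = real (card Q) / real ((n + m) * (n + m - 1 choose (b - 1 + k)))"
  proof -
    have "x * y = x / z" if "z * y = 1" for x y z :: real
      using that by (cases "z = 0") (auto simp: field_simps)
    then show ?thesis
      using prob_lower_set_at[OF J_def j(1,2), unfolded j(3)] by blast
  qed
  also have "\<dots> = real (m choose k) * (fact n * fact (k + b - 1) * fact (m - k + (n - b))) /
      (fact (b - 1) * fact (n - b) * fact (m + n))"
  proof -
    have 1: "real n * real (n - 1 choose (b - 1)) = fact n / (fact (b - 1) * fact (n - b))"
      using b by (simp add: binomial_fact fact_reduce[of n])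
    \<comment> \<open>The complement of a set of size \<open>b - 1 + k\<close> among
      \<open>n + m - 1\<close> indices has size \<open>m - k + (n - b)\<close>.\<close>
    have 2: "real (n + m) * real (n + m - 1 choose (b - 1 + k)) =
        fact (m + n) / (fact (k + b - 1) * fact (m - k + (n - b)))"
    proof -
      have e: "b - 1 + k = k + b - 1" "n + m - 1 - (k + b - 1) = m - k + (n - b)"
        using b k by auto
      have "k + b - 1 \<le> n + m - 1"
        using b k by simp
      from binomial_fact[OF this, where 'a = real]
      have "real (n + m - 1 choose (b - 1 + k)) = fact (n + m - 1) / (fact (k + b - 1) * fact (m - k + (n - b)))"
        by (simp only: e)
      moreover have "fact (m + n) = real (n + m) * fact (n + m - 1)"
        using b fact_reduce[of "n + m", where 'a = real] by (simp add: add.commute[of m n])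
      ultimately show ?thesis
        by (simp only: times_divide_eq_right)
    qed
    have "real (card Q) / real ((n + m) * (n + m - 1 choose (b - 1 + k))) =
        real (m choose k) * (real n * real (n - 1 choose (b - 1))) / (real (n + m) * real (n + m - 1 choose (b - 1 + k)))"
      by (simp add: cardQ)
    also have "\<dots> = real (m choose k) * (fact n / (fact (b - 1) * fact (n - b))) /
        (fact (m + n) / (fact (k + b - 1) * fact (m - k + (n - b))))"
      by (simp only: 1 2)
    finally show ?thesis
      by simp
  qed
  finally show ?thesis .
qed

end

subsection \<open>The Beta-Binomial distribution\<close>

lemma sets_beta_binomial: "sets (beta_binomial m b g) = UNIV"
proof -
  have "space (beta_distribution b g) = {0<..<1}"
    by (simp add: beta_distribution_def space_restrict_space)
  then have "sets (beta_binomial m b g) = sets (count_space UNIV)"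
    unfolding beta_binomial_def by (intro sets_bind) auto
  then show ?thesis by simp
qed

lemma Beta_of_nat:
  assumes "p \<ge> 1" "q \<ge> 1"
  shows "Beta (real p) (real q) = fact (p - 1) * fact (q - 1) / fact (p + q - 1)"
proof -
  have *: "Gamma (real k) = fact (k - 1)" if "k \<ge> 1" for k
    using Gamma_fact[of "k - 1", where 'a = real] that by (simp add: of_nat_diff)
  show ?thesis
    using assms *[of p] *[of q] *[of "p + q"] by (simp add: Beta_def)
qed

text \<open>Conjugacy: the Beta density times the binomial weight is a constant multiple of the
  kernel with parameters \<open>k + b\<close> and \<open>m - k + g\<close>, so the integral is a
  ratio of Beta values, rational in factorials for integer parameters.\<close>

lemma emeasure_beta_binomial_eq:
  assumes bg: "b \<ge> 1" "g \<ge> 1" and k: "k \<le> m"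
  shows "emeasure (beta_binomial m (real b) (real g)) {k} =
    ennreal (real (m choose k) * (fact (b + g - 1) * fact (k + b - 1) * fact (m - k + g - 1)) /
      (fact (b - 1) * fact (g - 1) * fact (m + (b + g - 1))))"
proof -
  let ?B = "Beta (real b) (real g)"
  let ?B' = "Beta (real (k + b)) (real (m - k + g))"
  let ?f = "\<lambda>\<theta>::real. real (m choose k) / ?B * (\<theta> powr (real (k + b) - 1) * (1 - \<theta>) powr (real (m - k + g) - 1))"
  have B: "?B > 0"
    using bg by (simp add: Beta_of_nat)
  have "((\<lambda>t. t powr (real (k + b) - 1) * (1 - t) powr (real (m - k + g) - 1)) has_integral ?B') {0<..<1}"
    using has_integral_Beta_real[of "real (k + b)" "real (m - k + g)"] bg by (simp add: has_integral_Icc_iff_Ioo)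
  then have I: "(?f has_integral (real (m choose k) / ?B * ?B')) {0<..<1}"
    by (rule has_integral_mult_right)
  have "emeasure (beta_binomial m (real b) (real g)) {k} =
      (\<integral>\<^sup>+\<theta>. ennreal (\<theta> powr (real b - 1) * (1 - \<theta>) powr (real g - 1) / ?B) *
        ennreal (real (m choose k) * \<theta> ^ k * (1 - \<theta>) ^ (m - k)) \<partial>restrict_space lborel {0<..<1})"
    unfolding emeasure_beta_binomial beta_distribution_def
    by (subst nn_integral_density) (auto simp: measurable_restrict_space1)
  also have "\<dots> = (\<integral>\<^sup>+\<theta>. ennreal (?f \<theta>) \<partial>restrict_space lborel {0<..<1})"
  proof (rule nn_integral_cong)
    fix \<theta> :: real assume "\<theta> \<in> space (restrict_space lborel {0<..<1})"
    then have t: "0 < \<theta>" "\<theta> < 1"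
      by (auto simp: space_restrict_space)
    \<comment> \<open>For bases in the open unit interval integer powers are real powers, so the
      exponents add up.\<close>
    have "?f \<theta> = \<theta> powr (real b - 1) * (1 - \<theta>) powr (real g - 1) / ?B * (real (m choose k) * \<theta> ^ k * (1 - \<theta>) ^ (m - k))"
    proof -
      have "\<theta> powr (real (k + b) - 1) = \<theta> ^ k * \<theta> powr (real b - 1)"
        using t by (simp add: powr_realpow[symmetric] powr_add[symmetric] add_diff_eq)
      moreover have "(1 - \<theta>) powr (real (m - k + g) - 1) = (1 - \<theta>) ^ (m - k) * (1 - \<theta>) powr (real g - 1)"
        using t by (simp add: powr_realpow[symmetric] powr_add[symmetric] add_diff_eq)
      ultimately show ?thesis by simp
    qed
    moreover have "0 \<le> \<theta> powr (real b - 1) * (1 - \<theta>) powr (real g - 1) / ?B"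
      using B by simp
    ultimately show "ennreal (\<theta> powr (real b - 1) * (1 - \<theta>) powr (real g - 1) / ?B) *
        ennreal (real (m choose k) * \<theta> ^ k * (1 - \<theta>) ^ (m - k)) = ennreal (?f \<theta>)"
      by (simp only: ennreal_mult')
  qed
  also have "\<dots> = (\<integral>\<^sup>+\<theta>. ennreal (?f \<theta>) * indicator {0<..<1} \<theta> \<partial>lborel)"
    by (simp add: nn_integral_restrict_space)
  also have "\<dots> = ennreal (real (m choose k) / ?B * ?B')"
    by (rule nn_integral_has_integral_lebesgue'[OF _ I]) (use B in auto)
  finally have "emeasure (beta_binomial m (real b) (real g)) {k} = ennreal (real (m choose k) / ?B * ?B')" .
  moreover have "k + b + (m - k + g) - 1 = m + (b + g - 1)"
    using k bg by simp
  then have "?B' = fact (k + b - 1) * fact (m - k + g - 1) / fact (m + (b + g - 1))"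
    using bg Beta_of_nat[of "k + b" "m - k + g"] by (simp only:)
  then have "real (m choose k) / ?B * ?B' =
      real (m choose k) * (fact (b + g - 1) * fact (k + b - 1) * fact (m - k + g - 1)) /
        (fact (b - 1) * fact (g - 1) * fact (m + (b + g - 1)))"
    using bg by (simp only: Beta_of_nat) simp
  ultimately show ?thesis by simp
qed

subsection \<open>Coverage indicators\<close>

text \<open>The threshold test on scores is turned into a count by
  \<open>order_statistic_ge_iff\<close>. The prediction set contains only labels from
  \<open>\<Y>\<close>, whence the condition on \<open>Y\<close>.\<close>

lemma coverage_indicator_eq:
  assumes b: "b = nat \<lceil>(1 - \<alpha>) * (real n + 1)\<rceil>" "1 \<le> b" "b \<le> n" and Y: "Y (int n + i) \<omega> \<in> \<Y>"
  shows "coverage_indicator \<Y> X Y \<rho> n \<alpha> i \<omega> =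
    (if card {l \<in> {1..int n}. score X Y \<rho> l \<omega> < score X Y \<rho> (int n + i) \<omega>} < b then 1 else 0)"
  using order_statistic_ge_iff[OF b(2,3), of "score X Y \<rho> (int n + i) \<omega>" "\<lambda>i. score X Y \<rho> i \<omega>"] Y
  by (simp add: coverage_indicator_def prediction_set_def score_def b(1)[symmetric])

text \<open>With the shift \<open>d = n\<close> the head consists of the calibration scores, and
  \<open>Z i\<close> is one fixed function of them and of the score \<open>i + n\<close>.\<close>

lemma exchangeable_coverage_indicator:
  fixes S :: "int \<Rightarrow> 'w \<Rightarrow> real"
  assumes M: "prob_space M" and S: "exchangeable M borel 1 S"
    and Z: "\<And>i \<omega>. i \<ge> 1 \<Longrightarrow> \<omega> \<in> space M \<Longrightarrow>
      Z i \<omega> = (if card {l \<in> {1..int n}. S l \<omega> < S (int n + i) \<omega>} < b then 1 else (0::real))"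
  shows "exchangeable M borel 1 Z"
proof (rule exchangeable_transform[OF M S, where d = "int n"])
  let ?I = "{1..<1 + int n}"
  let ?K = "PiM ?I (\<lambda>_. borel) \<Otimes>\<^sub>M (borel :: real measure)"
  let ?c = "\<lambda>p :: (int \<Rightarrow> real) \<times> real. card {l \<in> ?I. fst p l < snd p} < b"
  fix A :: "real set"
  let ?B = "{p \<in> space ?K. (if ?c p then 1 else 0) \<in> A}"
  \<comment> \<open>The indicator depends on \<open>p\<close> only through the finite set of
    calibration indices whose scores are below \<open>snd p\<close>.\<close>
  have "Measurable.pred ?K (\<lambda>p. (if card {l \<in> ?I. fst p l < snd p} < b then 1 else 0) \<in> A)"
  proof (rule pred_Collect_finite)
    fix l assume "l \<in> ?I"
    then have "(\<lambda>p. fst p l) \<in> borel_measurable ?K"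
      by (intro measurable_compose[OF measurable_fst] measurable_component_singleton)
    then show "Measurable.pred ?K (\<lambda>p. fst p l < snd p)"
      by (intro borel_measurable_pred_less) auto
  qed simp
  then have "?B \<in> sets ?K"
    by (simp add: pred_def)
  moreover have "Z i \<omega> \<in> A \<longleftrightarrow> (\<lambda>j\<in>?I. S j \<omega>, S (i + int n) \<omega>) \<in> ?B" if "i \<ge> 1" "\<omega> \<in> space M" for i \<omega>
  proof -
    have "{l \<in> {1..int n}. S l \<omega> < S (int n + i) \<omega>} = {l \<in> ?I. (\<lambda>j\<in>?I. S j \<omega>) l < S (i + int n) \<omega>}"
      by (auto simp: add.commute)
    then show ?thesis
      using Z[OF that] by (simp add: space_pair_measure space_PiM)
  qed
  ultimately show "\<exists>B\<in>sets ?K. \<forall>i\<ge>1. \<forall>\<omega>\<in>space M. Z i \<omega> \<in> A \<longleftrightarrow> (\<lambda>j\<in>?I. S j \<omega>, S (i + int n) \<omega>) \<in> B"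
    by blast
qed auto

section \<open>From score counts to the law of the empirical coverage\<close>

theorem theorem1:
  fixes M :: "'w measure"
    and X :: "int \<Rightarrow> 'w \<Rightarrow> real ^ 'd"
    and Y :: "int \<Rightarrow> 'w \<Rightarrow> real"
    and \<Y> :: "real set"
    and \<rho> :: "real ^ 'd \<Rightarrow> real \<Rightarrow> 'w \<Rightarrow> real"
    and t n b g :: nat
    and \<alpha> :: real
  assumes "prob_space M"
    and "label_set \<Y>"
    and "t \<ge> 1" and "n \<ge> 1" and "0 < \<alpha>" and "\<alpha> < 1"
    and "feasible n \<alpha>"
    and "exchangeable M (observable_space \<Y>) (1 - int t) (\<lambda>i \<omega>. (X i \<omega>, Y i \<omega>))"
    and "conformity_function M \<Y> t X Y \<rho>"
    and "jointly_measurable M \<Y> t X Y \<rho>"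
    and "regular M X Y \<rho>"
    and b: "b = nat \<lceil>(1 - \<alpha>) * (real n + 1)\<rceil>"
    and g: "g = nat \<lfloor>\<alpha> * (real n + 1)\<rfloor>"
  shows "exchangeable M borel 1 (coverage_indicator \<Y> X Y \<rho> n \<alpha>) \<and>
    (\<forall>m\<ge>1.
      distr M borel (\<lambda>\<omega>. real m * empirical_coverage \<Y> X Y \<rho> n \<alpha> m \<omega>) =
        distr (beta_binomial m (real b) (real g)) borel real \<and>
      (\<forall>k\<le>m.
        measure M {\<omega> \<in> space M. empirical_coverage \<Y> X Y \<rho> n \<alpha> m \<omega> = real k / real m} =
          real (m choose k) *
            (fact n * fact (k + b - 1) * fact (m - k + g - 1)) /
            (fact (b - 1) * fact (g - 1) * fact (m + n))))"
proof -
  define S where "S = score X Y \<rho>"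
  have exch: "exchangeable M borel 1 S"
    unfolding S_def by (rule exchangeable_score[OF assms(1,8,10)])
  interpret exchangeable_scores M S
    using assms(1,11) exch
    by (simp add: exchangeable_scores_def exchangeable_scores_axioms_def regular_def S_def)
  \<comment> \<open>Positivity makes the ceiling at least 1, so \<open>nat\<close> truncates
    nothing; feasibility gives the upper bound.\<close>
  have "0 < (1 - \<alpha>) * (real n + 1)"
    using assms(6) by simp
  then have b1: "1 \<le> b" and bn: "b \<le> n"
    using assms(7) b unfolding feasible_def by linarith+
  \<comment> \<open>The two arguments sum to the integer \<open>n + 1\<close>, so floor and ceiling
    are complementary: \<open>b + g = n + 1\<close>.\<close>
  have "\<alpha> * (real n + 1) = real_of_int (int n + 1) - (1 - \<alpha>) * (real n + 1)"
    by (simp add: algebra_simps)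
  then have "\<lfloor>\<alpha> * (real n + 1)\<rfloor> = int n + 1 - \<lceil>(1 - \<alpha>) * (real n + 1)\<rceil>"
    by linarith
  then have gb: "g = n + 1 - b"
    using b b1 bn g by linarith
  have Z: "coverage_indicator \<Y> X Y \<rho> n \<alpha> i \<omega> =
      (if card {l \<in> {1..int n}. S l \<omega> < S (int n + i) \<omega>} < b then 1 else 0)"
    if "i \<ge> 1" "\<omega> \<in> space M" for i \<omega>
  proof -
    have "(\<lambda>\<omega>. (X (int n + i) \<omega>, Y (int n + i) \<omega>)) \<in> measurable M (observable_space \<Y>)"
      using assms(8) that(1) by (simp add: exchangeable_def)
    from measurable_space[OF this that(2)] have "Y (int n + i) \<omega> \<in> \<Y>"
      by (simp add: observable_space_def space_pair_measure space_restrict_space)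
    then show ?thesis
      unfolding S_def by (rule coverage_indicator_eq[OF b b1 bn])
  qed
  have "exchangeable M borel 1 (coverage_indicator \<Y> X Y \<rho> n \<alpha>)"
    using exchangeable_coverage_indicator[OF assms(1) exch Z] .
  moreover have "distr M borel (\<lambda>\<omega>. real m * empirical_coverage \<Y> X Y \<rho> n \<alpha> m \<omega>) =
        distr (beta_binomial m (real b) (real g)) borel real \<and>
      (\<forall>k\<le>m.
        measure M {\<omega> \<in> space M. empirical_coverage \<Y> X Y \<rho> n \<alpha> m \<omega> = real k / real m} =
          real (m choose k) *
            (fact n * fact (k + b - 1) * fact (m - k + g - 1)) /
            (fact (b - 1) * fact (g - 1) * fact (m + n)))" if m: "m \<ge> 1" for m
  proof -
    \<comment> \<open>The number of covered observables in the batch, as a natural number so that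
      its law can be compared with \<open>beta_binomial\<close> directly.\<close>
    define K where "K \<omega> = card {i \<in> {1..int m}. card {l \<in> {1..int n}. S l \<omega> < S (int n + i) \<omega>} < b}" for \<omega>
    have sum: "real m * empirical_coverage \<Y> X Y \<rho> n \<alpha> m \<omega> = real (K \<omega>)" if "\<omega> \<in> space M" for \<omega>
    proof -
      have "(\<Sum>i = 1..int m. coverage_indicator \<Y> X Y \<rho> n \<alpha> i \<omega>) =
          (\<Sum>i = 1..int m. if card {l \<in> {1..int n}. S l \<omega> < S (int n + i) \<omega>} < b then 1 else 0)"
        using that by (intro sum.cong refl Z) auto
      also have "\<dots> = real (K \<omega>)"
        by (simp add: K_def sum.If_cases Int_def)
      finally show ?thesis
        using m by (simp add: empirical_coverage_def)
    qed
    have K_pred: "Measurable.pred M (\<lambda>\<omega>. K \<omega> = k)" for k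
      unfolding K_def by (intro pred_Collect_finite pred_S_less) auto
    have "K -` A \<inter> space M = (\<Union>k\<in>A. {\<omega> \<in> space M. K \<omega> = k})" for A
      by auto
    then have K_meas: "K \<in> measurable M (count_space UNIV)"
      using K_pred by (intro measurableI) (auto simp: pred_def)
    have prob_K: "prob {\<omega> \<in> space M. K \<omega> = k} =
        real (m choose k) * (fact n * fact (k + b - 1) * fact (m - k + g - 1)) /
          (fact (b - 1) * fact (g - 1) * fact (m + n))" if "k \<le> m" for k
    proof -
      have "g - 1 = n - b" "m - k + g - 1 = m - k + (n - b)"
        using gb bn by auto
      then show ?thesis
        unfolding K_def by (simp only: prob_coverage_count[OF b1 bn that])
    qed
    have K_le: "K \<omega> \<le> m" for \<omega>
    proof -
      have "K \<omega> \<le> card {1..int m}"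
        unfolding K_def by (intro card_mono) auto
      then show ?thesis by simp
    qed
    \<comment> \<open>On the natural numbers singletons suffice. For \<open>k > m\<close> both sides
      vanish, since \<open>K \<omega> \<le> m\<close> and \<open>m choose k\<close> is 0.\<close>
    have law: "distr M (count_space UNIV) K = beta_binomial m (real b) (real g)"
    proof (rule measure_eqI_countable)
      fix k :: nat
      have L: "emeasure (distr M (count_space UNIV) K) {k} = ennreal (prob {\<omega> \<in> space M. K \<omega> = k})"
        using K_meas by (simp add: emeasure_distr vimage_def Int_def conj_commute emeasure_eq_measure)
      show "emeasure (distr M (count_space UNIV) K) {k} = emeasure (beta_binomial m (real b) (real g)) {k}"
      proof (cases "k \<le> m")
        case True
        have "b + g - 1 = n" "1 \<le> g"
          using gb b1 bn by auto
        then show ?thesis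
          unfolding L prob_K[OF True] using emeasure_beta_binomial_eq[OF b1 _ True, of g] by simp
      next
        case False
        then have "K \<omega> \<noteq> k" for \<omega>
          using K_le[of \<omega>] by auto
        with False show ?thesis
          unfolding L by (simp add: emeasure_beta_binomial binomial_eq_0)
      qed
    qed (auto simp: sets_beta_binomial)
    have "distr M borel (\<lambda>\<omega>. real m * empirical_coverage \<Y> X Y \<rho> n \<alpha> m \<omega>) = distr M borel (\<lambda>\<omega>. real (K \<omega>))"
      using sum by (intro distr_cong) auto
    also have "\<dots> = distr (distr M (count_space UNIV) K) borel real"
      using K_meas by (subst distr_distr) (auto simp: comp_def)
    finally have "distr M borel (\<lambda>\<omega>. real m * empirical_coverage \<Y> X Y \<rho> n \<alpha> m \<omega>) =
        distr (beta_binomial m (real b) (real g)) borel real"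
      by (simp only: law)
    moreover have "{\<omega> \<in> space M. empirical_coverage \<Y> X Y \<rho> n \<alpha> m \<omega> = real k / real m} =
        {\<omega> \<in> space M. K \<omega> = k}" for k
    proof (rule Collect_cong, rule conj_cong[OF refl])
      fix \<omega> assume "\<omega> \<in> space M"
      have "empirical_coverage \<Y> X Y \<rho> n \<alpha> m \<omega> = real k / real m \<longleftrightarrow>
          real m * empirical_coverage \<Y> X Y \<rho> n \<alpha> m \<omega> = real k"
        using m by (simp add: field_simps)
      then show "empirical_coverage \<Y> X Y \<rho> n \<alpha> m \<omega> = real k / real m \<longleftrightarrow> K \<omega> = k"
        using sum[OF \<open>\<omega> \<in> space M\<close>] by simp
    qed
    ultimately show ?thesis
      using prob_K by simp
  qed
  ultimately show ?thesis
    by blast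
qed

end
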